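(* Let $f:\mathbb{R}^n\to\mathbb{R}$, $x^0\in\mathbb{R}^n$, $\overline{H}$ a real symmetric $n\times n$ matrix, and $Y=\{x^0\}\cup\{x^0+d^i:i=1,\ldots,m\}\subseteq\mathbb{R}^n$. Suppose that $Y$ lies in the $d$-dimensional affine space $\mathcal{Y}=\{x^0+Q\widehat{x}:\widehat{x}\in\mathbb{R}^d\}$, where $d<n$ and $Q\in\mathbb{R}^{n\times d}$ has $d$ orthonormal columns, and that there exists a quadratic function that interpolates $f$ on $Y$. Let $\widehat{d}^i\in\mathbb{R}^d$ be such that $d^i=Q\widehat{d}^i$, let $\widehat{Y}=\{0\}\cup\{\widehat{d}^i:i=1,\ldots,m\}\subseteq\mathbb{R}^d$, let $\widehat{f}(\widehat{x})=f(x^0+Q\widehat{x})$ for $\widehat{x}\in\mathbb{R}^d$, and let $\widehat{\overline{H}}=Q^\top\overline{H}Q\in S_d(\mathbb{R})$. Then: (1) Both $\nabla_{\mathrm{LFU}}^2f(x^0;Y;\overline{H})$ and $\nabla_{\mathrm{LFU}}^2\widehat{f}(0;\widehat{Y};\widehat{\overline{H}})$ exist and are unique, and satisfy $$\nabla_{\mathrm{LFU}}^2f(x^0;Y;\overline{H})=Q\nabla_{\mathrm{LFU}}^2\widehat{f}(0;\widehat{Y};\widehat{\overline{H}})Q^\top+\overline{H}-QQ^\top\overline{H}QQ^\top.$$ (2) The sets of gradient approximations satisfy $$\mathcal{G}_{\mathrm{LFU}}^{x^0,Y,\overline{H}}=\left\{Q\alpha:\alpha\in\mathcal{G}_{\mathrm{LFU}}^{0,\widehat{Y},\widehat{\overline{H}}}\right\}+\mathrm{col}(Q)^\perp.$$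 (3) For any pair $(\nabla_{\mathrm{LFU}}f(x^0;Y;\overline{H}),\nabla_{\mathrm{LFU}}\widehat{f}(0;\widehat{Y};\widehat{\overline{H}}))\in\mathcal{G}_{\mathrm{LFU}}^{x^0,Y,\overline{H}}\times\mathcal{G}_{\mathrm{LFU}}^{0,\widehat{Y},\widehat{\overline{H}}}$ such that $\nabla_{\mathrm{LFU}}f(x^0;Y;\overline{H})-Q\nabla_{\mathrm{LFU}}\widehat{f}(0;\widehat{Y};\widehat{\overline{H}})\in\mathrm{col}(Q)^\perp$, the corresponding models satisfy $$m_{\mathrm{LFU}}^{x^0,Y,\overline{H}}(x)=\widehat{m}_{\mathrm{LFU}}^{0,\widehat{Y},\widehat{\overline{H}}}(\widehat{x})\quad\text{for all }(x,\widehat{x})\in\mathbb{R}^n\times\mathbb{R}^d\text{ with }x=x^0+Q\widehat{x}.$$ (4) In particular, if $\overline{H}=QQ^\top\overline{H}QQ^\top$ and $\nabla_{\mathrm{LFU}}f(x^0;Y;\overline{H})=Q\nabla_{\mathrm{LFU}}\widehat{f}(0;\widehat{Y};\widehat{\overline{H}})$, then $$m_{\mathrm{LFU}}^{x^0,Y,\overline{H}}(x)=\widehat{m}_{\mathrm{LFU}}^{0,\widehat{Y},\widehat{\overline{H}}}(\widehat{x})\quad\text{for all }(x,\widehat{x})\in\mathbb{R}^n\times\mathbb{R}^d\text{ with }x\in(x^0+Q\widehat{x})+\mathrm{col}(Q)^\perp.$$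
   Context: $S_k(\mathbb{R})$ is the set of real symmetric $k\times k$ matrices; $\|\cdot\|_F$ is the Frobenius norm; $\mathrm{col}(Q)^\perp$ is the orthogonal complement of the column space of $Q$; the sum of two sets of vectors is the Minkowski sum. A quadratic function is a polynomial of degree at most 2. Least Frobenius norm updating (LFU) models. For a function $g:\mathbb{R}^k\to\mathbb{R}$, a point $z^0\in\mathbb{R}^k$, a matrix $B\in S_k(\mathbb{R})$ and a sample set $Z=\{z^0\}\cup\{z^0+u^i:i=1,\ldots,m\}\subseteq\mathbb{R}^k$, let $\mathcal{M}_{\mathrm{LFU}}^{z^0,Z,B}$ be the set of minimizers $(\alpha,H)$ of $$\min_{\alpha\in\mathbb{R}^k,\ H\in S_k(\mathbb{R})}\ \tfrac12\|H-B\|_F^2\quad\text{s.t. }(u^i)^\top\alpha+\tfrac12(u^i)^\top Hu^i=g(z^0+u^i)-g(z^0),\ i=1,\ldots,m.$$ An element of this set is denoted $(\nabla_{\mathrm{LFU}}g(z^0;Z;B),\nabla^2_{\mathrm{LFU}}g(z^0;Z;B))$; uniqueness of $\nabla^2_{\mathrm{LFU}}g(z^0;Z;B)$ means that all minimizers share the same second component. The set of all first components of elements of $\mathcal{M}_{\mathrm{LFU}}^{z^0,Z,B}$ is denoted $\mathcal{G}_{\mathrm{LFU}}^{z^0,Z,B}$ (it need not be a singleton). The LFU model corresponding to such a pair is $$m_{\mathrm{LFU}}^{z^0,Z,B}(z)=g(z^0)+\nabla_{\mathrm{LFU}}g(z^0;Z;B)^\top(z-z^0)+\tfrac12(z-z^0)^\top\nabla^2_{\mathrm{LFU}}g(z^0;Z;B)(z-z^0).$$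 In the claim, the full-space objects are obtained with $k=n$, $g=f$, $z^0=x^0$, $Z=Y$, $u^i=d^i$, $B=\overline{H}$, and the subspace objects (the model being written $\widehat{m}_{\mathrm{LFU}}^{0,\widehat{Y},\widehat{\overline{H}}}$) with $k=d$, $g=\widehat{f}$, $z^0=0$, $Z=\widehat{Y}$, $u^i=\widehat{d}^i$, $B=\widehat{\overline{H}}$. *)

theory Defs
  imports "HOL-Analysis.Analysis"
begin

definition sym_matrices :: "(real^'k^'k) set" where
  "sym_matrices = {A. transpose A = A}"

text \<open>The norm of \<^typ>\<open>real^'k^'k\<close> is the Frobenius norm; it is used as such below.\<close>

lemma norm_matrix_eq_Frobenius:
  fixes A :: "real^'c^'r"
  shows "norm A = sqrt (\<Sum>i\<in>UNIV. \<Sum>j\<in>UNIV. (A $ i $ j)\<^sup>2)"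
  by (simp add: norm_vec_def L2_set_def sum_nonneg)

text \<open>Polynomials of degree at most 2, as linear combinations of the monomials of degree 0, 1, 2.\<close>

definition quadratic_function :: "(real^'k \<Rightarrow> real) \<Rightarrow> bool" where
  "quadratic_function q \<longleftrightarrow>
     (\<exists>(c::real) (a::real^'k) (b::real^'k^'k).
        \<forall>x. q x = c + (\<Sum>i\<in>UNIV. a $ i * x $ i)
                   + (\<Sum>i\<in>UNIV. \<Sum>j\<in>UNIV. b $ i $ j * x $ i * x $ j))"

definition orthonormal_columns :: "real^'d^'n \<Rightarrow> bool" where
  "orthonormal_columns Q \<longleftrightarrow>
     (\<forall>i j. column i Q \<bullet> column j Q = (if i = j then 1 else 0))"

definition col_space :: "real^'d^'n \<Rightarrow> (real^'n) set" where
  "col_space Q = span (columns Q)"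

text \<open>
  A sample set is given by its base point \<open>z0\<close> and the displacements \<open>u 1, \<dots>, u m\<close>
  (values of \<open>u\<close> outside \<open>{1..m}\<close> are irrelevant; displacements may repeat or vanish).
\<close>

definition sample_set :: "real^'k \<Rightarrow> nat \<Rightarrow> (nat \<Rightarrow> real^'k) \<Rightarrow> (real^'k) set" where
  "sample_set z0 m u = {z0} \<union> {z0 + u i |i. i \<in> {1..m}}"

definition lfu_feasible ::
  "(real^'k \<Rightarrow> real) \<Rightarrow> real^'k \<Rightarrow> nat \<Rightarrow> (nat \<Rightarrow> real^'k) \<Rightarrow> (real^'k) \<times> (real^'k^'k) \<Rightarrow> bool" where
  "lfu_feasible g z0 m u = (\<lambda>(\<alpha>, H).
     H \<in> sym_matrices \<and>
     (\<forall>i\<in>{1..m}. u i \<bullet> \<alpha> + 1/2 * (u i \<bullet> (H *v u i)) = g (z0 + u i) - g z0))"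

definition lfu_minimizers ::
  "(real^'k \<Rightarrow> real) \<Rightarrow> real^'k \<Rightarrow> nat \<Rightarrow> (nat \<Rightarrow> real^'k) \<Rightarrow> real^'k^'k \<Rightarrow> ((real^'k) \<times> (real^'k^'k)) set" where
  "lfu_minimizers g z0 m u B =
     {p. is_arg_min (\<lambda>(\<alpha>, H). 1/2 * (norm (H - B))\<^sup>2) (lfu_feasible g z0 m u) p}"

definition lfu_gradients ::
  "(real^'k \<Rightarrow> real) \<Rightarrow> real^'k \<Rightarrow> nat \<Rightarrow> (nat \<Rightarrow> real^'k) \<Rightarrow> real^'k^'k \<Rightarrow> (real^'k) set" where
  "lfu_gradients g z0 m u B = fst ` lfu_minimizers g z0 m u B"

definition lfu_hessians ::
  "(real^'k \<Rightarrow> real) \<Rightarrow> real^'k \<Rightarrow> nat \<Rightarrow> (nat \<Rightarrow> real^'k) \<Rightarrow> real^'k^'k \<Rightarrow> (real^'k^'k) set" where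
  "lfu_hessians g z0 m u B = snd ` lfu_minimizers g z0 m u B"

text \<open>Only meaningful when \<^const>\<open>lfu_hessians\<close> is a singleton.\<close>

definition lfu_hessian ::
  "(real^'k \<Rightarrow> real) \<Rightarrow> real^'k \<Rightarrow> nat \<Rightarrow> (nat \<Rightarrow> real^'k) \<Rightarrow> real^'k^'k \<Rightarrow> real^'k^'k" where
  "lfu_hessian g z0 m u B = (THE H. H \<in> lfu_hessians g z0 m u B)"

text \<open>
  The minimizing gradient need not be unique, so the model takes the chosen element \<open>\<alpha>\<close>
  of \<^const>\<open>lfu_gradients\<close> as an argument.
\<close>

definition lfu_model ::
  "(real^'k \<Rightarrow> real) \<Rightarrow> real^'k \<Rightarrow> nat \<Rightarrow> (nat \<Rightarrow> real^'k) \<Rightarrow> real^'k^'k \<Rightarrow> real^'k \<Rightarrow> real^'k \<Rightarrow> real" where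
  "lfu_model g z0 m u B \<alpha> z =
     g z0 + \<alpha> \<bullet> (z - z0) + 1/2 * ((z - z0) \<bullet> (lfu_hessian g z0 m u B *v (z - z0)))"

end

theory Submission
  imports Defs
begin

text \<open>
  The Hessian components of feasible pairs form an affine set, so the minimizing Hessian is the
  metric projection of the reference matrix onto it. Conjugation by \<open>Q\<close>, that is
  \<open>M \<mapsto> Q M Q\<^sup>T\<close>, is a Frobenius isometry with adjoint and left inverse \<open>A \<mapsto> Q\<^sup>T A Q\<close>, and
  feasibility of \<open>(\<alpha>, A)\<close> depends only on \<open>(Q\<^sup>T \<alpha>, Q\<^sup>T A Q)\<close>. By Pythagoras,
  \<open>(\<alpha>, A)\<close> is therefore a minimizer iff its compression is one for the subspace problem and \<open>A - H\<close>
  lies in the range of the conjugation.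
\<close>

section \<open>Frobenius inner products, conjugation and compression\<close>

lemma inner_matrix_mult_right:
  fixes X :: "real^'b^'a"
  shows "(X ** R) \<bullet> Y = X \<bullet> (Y ** transpose R)"
proof -
  have "(X ** R) \<bullet> Y = (\<Sum>i\<in>UNIV. \<Sum>j\<in>UNIV. \<Sum>k\<in>UNIV. X $ i $ k * R $ k $ j * Y $ i $ j)"
    by (simp add: inner_vec_def matrix_matrix_mult_def sum_distrib_right)
  also have "\<dots> = (\<Sum>i\<in>UNIV. \<Sum>k\<in>UNIV. \<Sum>j\<in>UNIV. X $ i $ k * R $ k $ j * Y $ i $ j)"
    by (rule sum.cong[OF refl], rule sum.swap)
  also have "\<dots> = X \<bullet> (Y ** transpose R)"
    by (simp add: inner_vec_def matrix_matrix_mult_def transpose_def sum_distrib_left mult_ac)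
  finally show ?thesis .
qed

lemma inner_transpose_transpose:
  fixes X :: "real^'b^'a"
  shows "transpose X \<bullet> transpose Y = X \<bullet> Y"
  unfolding inner_vec_def transpose_def by (simp, rule sum.swap)

text \<open>Transposition preserves the Frobenius inner product and exchanges left with right
  multiplication, so this follows from the right-hand case.\<close>

lemma inner_matrix_mult_left:
  fixes X :: "real^'b^'a"
  shows "(R ** X) \<bullet> Y = X \<bullet> (transpose R ** Y)"
proof -
  have "(R ** X) \<bullet> Y = (transpose X ** transpose R) \<bullet> transpose Y"
    by (metis inner_transpose_transpose matrix_transpose_mul)
  also have "\<dots> = transpose X \<bullet> (transpose Y ** R)"
    by (simp add: inner_matrix_mult_right)
  also have "\<dots> = X \<bullet> (transpose R ** Y)"
    by (metis inner_transpose_transpose matrix_transpose_mul transpose_transpose)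
  finally show ?thesis .
qed

lemma inner_sandwich:
  fixes Q :: "real^'d^'n"
  shows "(Q ** C ** transpose Q) \<bullet> Y = C \<bullet> (transpose Q ** Y ** Q)"
  by (subst inner_matrix_mult_right, subst inner_matrix_mult_left) (simp add: matrix_mul_assoc)

text \<open>The outer factors are independent, so that one linearity fact serves both the
  conjugation by \<open>Q\<close> and the compression in the opposite direction.\<close>

lemma linear_matrix_sandwich:
  fixes R :: "real^'b^'a" and S :: "real^'d^'c"
  shows "linear (\<lambda>M. R ** M ** S)"
proof (rule linearI)
  show "R ** (c *\<^sub>R M) ** S = c *\<^sub>R (R ** M ** S)" for c M
    by (simp add: vec_eq_iff matrix_matrix_mult_def sum_distrib_left sum_distrib_right mult_ac)
qed (simp add: matrix_add_ldistrib matrix_matrix_mult_def vec_eq_iff sum.distrib sum_distrib_right algebra_simps)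

lemmas matrix_sandwich_diff = linear_diff[OF linear_matrix_sandwich]
lemmas matrix_sandwich_add = linear_add[OF linear_matrix_sandwich]

lemma transpose_mult_self_orthonormal:
  assumes "orthonormal_columns Q"
  shows "transpose Q ** Q = mat 1"
  using assms by (auto simp: orthonormal_columns_def matrix_mult_transpose_dot_column mat_def vec_eq_iff)

text \<open>The entries of \<open>transpose Q *v w\<close> are the inner products of
  \<open>w\<close> with the columns, and orthogonality to the columns extends to their span.
  Membership in the complement thus becomes an equation to calculate with.\<close>

lemma mem_col_space_comp_iff: "w \<in> (col_space Q)\<^sup>\<bottom> \<longleftrightarrow> transpose Q *v w = 0"
proof -
  have "w \<in> (col_space Q)\<^sup>\<bottom> \<longleftrightarrow> (\<forall>y \<in> columns Q. y \<bullet> w = 0)"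
  proof
    assume "\<forall>y \<in> columns Q. y \<bullet> w = 0"
    then have "orthogonal w y" if "y \<in> span (columns Q)" for y
      using orthogonal_to_span[OF that] by (auto simp: orthogonal_def inner_commute)
    then show "w \<in> (col_space Q)\<^sup>\<bottom>"
      by (auto simp: orthogonal_comp_def col_space_def orthogonal_commute)
  qed (auto simp: orthogonal_comp_def col_space_def orthogonal_def span_base)
  also have "\<dots> \<longleftrightarrow> transpose Q *v w = 0"
  proof -
    have "(transpose Q *v w) $ i = column i Q \<bullet> w" for i
      by (simp add: matrix_vector_mult_def transpose_def column_def inner_vec_def
          del: transpose_matrix_vector)
    then show ?thesis unfolding columns_def vec_eq_iff[of "transpose Q *v w"] by auto
  qed
  finally show ?thesis .
qed

lemma sandwich_cancel:
  fixes Q :: "real^'d^'n"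
  assumes "transpose Q ** Q = mat 1"
  shows "transpose Q ** (Q ** M ** transpose Q) ** Q = M"
proof -
  have "transpose Q ** (Q ** M ** transpose Q) ** Q = (transpose Q ** Q) ** M ** (transpose Q ** Q)"
    by (simp only: matrix_mul_assoc)
  then show ?thesis by (simp add: assms)
qed

lemma norm_sandwich:
  fixes Q :: "real^'d^'n"
  assumes "transpose Q ** Q = mat 1"
  shows "norm (Q ** M ** transpose Q) = norm M"
proof -
  have "(Q ** M ** transpose Q) \<bullet> (Q ** M ** transpose Q) = M \<bullet> M"
    by (simp only: inner_sandwich sandwich_cancel[OF assms])
  then show ?thesis by (simp add: norm_eq)
qed

text \<open>\<open>Q ** C ** transpose Q\<close> is the orthogonal projection of \<open>M\<close>
  onto the range of the conjugation: its inner products with \<open>M\<close> and with itself both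
  equal \<open>C \<bullet> C\<close>, so it is orthogonal to the remainder.\<close>

lemma norm_compression_pythagoras:
  fixes Q :: "real^'d^'n" and M :: "real^'n^'n"
  assumes Q: "transpose Q ** Q = mat 1"
  defines "C \<equiv> transpose Q ** M ** Q"
  shows "(norm M)\<^sup>2 = (norm C)\<^sup>2 + (norm (M - Q ** C ** transpose Q))\<^sup>2"
proof -
  let ?P = "Q ** C ** transpose Q"
  have "?P \<bullet> M = C \<bullet> C"
    by (simp only: inner_sandwich C_def)
  moreover have "?P \<bullet> ?P = C \<bullet> C"
    using norm_sandwich[OF Q, of C] by (simp add: norm_eq)
  ultimately show ?thesis
    by (simp add: power2_norm_eq_inner inner_diff_left inner_diff_right inner_commute)
qed

section \<open>Symmetric matrices, the feasible set and the unique minimizing Hessian\<close>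

lemma sym_matrices_compression:
  assumes "A \<in> sym_matrices"
  shows "transpose Q ** A ** Q \<in> sym_matrices"
  using assms by (simp add: sym_matrices_def matrix_transpose_mul matrix_mul_assoc)

lemma sym_matrices_sandwich:
  assumes "A \<in> sym_matrices"
  shows "Q ** A ** transpose Q \<in> sym_matrices"
  using sym_matrices_compression[OF assms, of "transpose Q"] by simp

lemma subspace_sym_matrices: "subspace sym_matrices"
  by (auto simp: subspace_def sym_matrices_def transpose_def vec_eq_iff)

text \<open>The interpolation conditions are linear equations in the pair
  \<open>(\<alpha>, H)\<close> jointly, and symmetry cuts out a linear subspace.\<close>

lemma affine_lfu_feasible: "affine (Collect (lfu_feasible g z0 m u))"
proof (unfold affine_def, intro ballI allI impI)
  fix p q :: "(real^'a) \<times> (real^'a^'a)" and s t :: real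
  assume p: "p \<in> Collect (lfu_feasible g z0 m u)" and q: "q \<in> Collect (lfu_feasible g z0 m u)"
    and st: "s + t = 1"
  obtain \<alpha> A \<beta> B where [simp]: "p = (\<alpha>, A)" "q = (\<beta>, B)" by fastforce
  have "s *\<^sub>R A + t *\<^sub>R B \<in> sym_matrices"
    using p q by (intro subspace_add subspace_scale subspace_sym_matrices) (auto simp: lfu_feasible_def)
  moreover have "u i \<bullet> (s *\<^sub>R \<alpha> + t *\<^sub>R \<beta>) + 1/2 * (u i \<bullet> ((s *\<^sub>R A + t *\<^sub>R B) *v u i))
      = g (z0 + u i) - g z0" if "i \<in> {1..m}" for i
  proof -
    have "u i \<bullet> (s *\<^sub>R \<alpha> + t *\<^sub>R \<beta>) + 1/2 * (u i \<bullet> ((s *\<^sub>R A + t *\<^sub>R B) *v u i))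
      = s * (u i \<bullet> \<alpha> + 1/2 * (u i \<bullet> (A *v u i))) + t * (u i \<bullet> \<beta> + 1/2 * (u i \<bullet> (B *v u i)))"
      by (simp add: matrix_vector_mult_add_rdistrib scaleR_matrix_vector_assoc[symmetric]
          inner_add_right algebra_simps)
    also have "\<dots> = (s + t) * (g (z0 + u i) - g z0)"
      using p q that by (simp add: lfu_feasible_def distrib_right)
    finally show ?thesis using st by simp
  qed
  ultimately show "s *\<^sub>R p + t *\<^sub>R q \<in> Collect (lfu_feasible g z0 m u)"
    by (simp add: lfu_feasible_def)
qed

lemma lfu_minimizers_iff:
  "(\<alpha>, A) \<in> lfu_minimizers g z0 m u B \<longleftrightarrow>
     lfu_feasible g z0 m u (\<alpha>, A) \<and>
     (\<forall>\<beta> C. lfu_feasible g z0 m u (\<beta>, C) \<longrightarrow> norm (A - B) \<le> norm (C - B))"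
  by (auto simp: lfu_minimizers_def is_arg_min_def not_less split: prod.splits)

text \<open>The objective ignores the gradient, so only the set \<open>S\<close> of Hessian
  components matters. As a linear image of an affine set it is affine, hence closed and convex in
  finite dimension, and the point of \<open>S\<close> nearest to \<open>B\<close> exists and is
  unique.\<close>

lemma lfu_hessians_ex1:
  assumes "lfu_feasible g z0 m u (\<alpha>0, A0)"
  shows "\<exists>!A. A \<in> lfu_hessians g z0 m u B"
proof -
  define S where "S = snd ` Collect (lfu_feasible g z0 m u)"
  have S: "A \<in> S \<longleftrightarrow> (\<exists>\<alpha>. lfu_feasible g z0 m u (\<alpha>, A))" for A
    by (force simp: S_def)
  have "affine S"
    using affine_hull_linear_image[OF bounded_linear_snd, of "Collect (lfu_feasible g z0 m u)"]
    by (metis S_def affine_hull_eq affine_lfu_feasible)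
  then have "closed S" "convex S"
    by (metis affine_hull_eq closed_affine_hull, simp add: affine_imp_convex)
  have "S \<noteq> {}" using assms S by blast
  have hess: "A \<in> lfu_hessians g z0 m u B \<longleftrightarrow> A \<in> S \<and> (\<forall>C\<in>S. dist B A \<le> dist B C)" for A
  proof -
    have "A \<in> lfu_hessians g z0 m u B \<longleftrightarrow> (\<exists>\<alpha>. (\<alpha>, A) \<in> lfu_minimizers g z0 m u B)"
      by (force simp: lfu_hessians_def)
    then show ?thesis
      by (auto simp: S lfu_minimizers_iff dist_norm norm_minus_commute[of B])
  qed
  show ?thesis
  proof (rule ex1I)
    show "closest_point S B \<in> lfu_hessians g z0 m u B"
      using hess closest_point_exists[OF \<open>closed S\<close> \<open>S \<noteq> {}\<close>] by blast
    show "A = closest_point S B" if "A \<in> lfu_hessians g z0 m u B" for A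
      using that hess closest_point_unique[OF \<open>convex S\<close> \<open>closed S\<close>] by blast
  qed
qed

text \<open>The witness is the gradient and Hessian of \<open>q\<close> at \<open>z0\<close>; the
  second-order Taylor expansion of a quadratic is exact.\<close>

lemma quadratic_function_lfu_feasible:
  assumes "quadratic_function q" and "\<forall>y \<in> sample_set z0 m u. q y = g y"
  shows "\<exists>\<alpha> A. lfu_feasible g z0 m u (\<alpha>, A)"
proof -
  from assms(1) obtain c a b where q0: "\<And>x. q x = c + (\<Sum>i\<in>UNIV. a $ i * x $ i)
      + (\<Sum>i\<in>UNIV. \<Sum>j\<in>UNIV. b $ i $ j * x $ i * x $ j)"
    unfolding quadratic_function_def by blast
  have q: "q x = c + a \<bullet> x + x \<bullet> (b *v x)" for x
    by (simp add: q0 inner_vec_def matrix_vector_mult_def sum_distrib_left mult_ac)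
  have tr: "x \<bullet> (transpose b *v y) = y \<bullet> (b *v x)" for x y
    by (metis dot_lmul_matrix inner_commute transpose_matrix_vector)
  \<comment> \<open>The coefficient matrix \<open>b\<close> may be asymmetric; the Hessian of
    \<open>x \<bullet> (b *v x)\<close> is its symmetrization without the factor 1/2, which the
    constraint supplies.\<close>
  define A where "A = b + transpose b"
  have "A \<in> sym_matrices"
    by (simp add: A_def sym_matrices_def transpose_def vec_eq_iff)
  moreover have "u i \<bullet> (a + A *v z0) + 1/2 * (u i \<bullet> (A *v u i)) = g (z0 + u i) - g z0"
    if "i \<in> {1..m}" for i
  proof -
    have "g (z0 + u i) - g z0 = q (z0 + u i) - q z0"
      using assms(2) that by (auto simp: sample_set_def)
    then show ?thesis
      by (simp add: q A_def tr matrix_vector_mult_add_rdistrib matrix_vector_right_distrib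
          inner_add_right inner_add_left inner_commute[of a] del: transpose_matrix_vector)
  qed
  ultimately have "lfu_feasible g z0 m u (a + A *v z0, A)" by (simp add: lfu_feasible_def)
  then show ?thesis by blast
qed

section \<open>Transfer between the full space and the subspace\<close>

lemma inner_matrix_vector_transpose:
  fixes Q :: "real^'d^'n"
  shows "(Q *v x) \<bullet> y = x \<bullet> (transpose Q *v y)"
  by (metis dot_lmul_matrix inner_commute transpose_matrix_vector)

text \<open>Each displacement is \<open>Q *v dh i\<close>, and moving \<open>Q\<close> across the
  inner products leaves only the compressed pair. Symmetry of \<open>A\<close> is assumed because it
  cannot be read off from the compression.\<close>

lemma lfu_feasible_compression_iff:
  fixes Q :: "real^'d^'n"
  assumes "A \<in> sym_matrices" and "\<forall>i\<in>{1..m}. d i = Q *v dh i"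
    and "\<forall>xh. fh xh = f (x0 + Q *v xh)"
  shows "lfu_feasible f x0 m d (\<alpha>, A) \<longleftrightarrow>
    lfu_feasible fh 0 m dh (transpose Q *v \<alpha>, transpose Q ** A ** Q)"
proof -
  have "d i \<bullet> \<alpha> = dh i \<bullet> (transpose Q *v \<alpha>)"
    "d i \<bullet> (A *v d i) = dh i \<bullet> ((transpose Q ** A ** Q) *v dh i)"
    if "i \<in> {1..m}" for i
    using assms(2) that
    by (simp_all add: inner_matrix_vector_transpose matrix_vector_mul_assoc matrix_mul_assoc
        del: transpose_matrix_vector)
  then show ?thesis
    using assms sym_matrices_compression[OF assms(1)]
    by (auto simp: lfu_feasible_def simp del: transpose_matrix_vector)
qed

text \<open>The equation for \<open>A\<close> says that \<open>A - H\<close> is the conjugate of its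
  own compression; it is solved for \<open>A\<close> to yield the Hessian formula directly.\<close>

lemma lfu_minimizers_compression_iff:
  fixes Q :: "real^'d^'n" and H :: "real^'n^'n"
  assumes H: "H \<in> sym_matrices" and Q: "transpose Q ** Q = mat 1"
    and d: "\<forall>i\<in>{1..m}. d i = Q *v dh i" and fh: "\<forall>xh. fh xh = f (x0 + Q *v xh)"
    and Hh: "Hh = transpose Q ** H ** Q"
  shows "(\<alpha>, A) \<in> lfu_minimizers f x0 m d H \<longleftrightarrow>
    (transpose Q *v \<alpha>, transpose Q ** A ** Q) \<in> lfu_minimizers fh 0 m dh Hh \<and>
    A = Q ** (transpose Q ** A ** Q) ** transpose Q + H - Q ** Hh ** transpose Q"
    (is "?L \<longleftrightarrow> ?M \<and> ?E")
proof -
  have feas: "lfu_feasible f x0 m d (\<beta>, C) \<longleftrightarrow> C \<in> sym_matrices \<and>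
      lfu_feasible fh 0 m dh (transpose Q *v \<beta>, transpose Q ** C ** Q)" for \<beta> C
    using lfu_feasible_compression_iff[OF _ d fh] by (auto simp: lfu_feasible_def)
  have pyth: "(norm (C - H))\<^sup>2 = (norm (transpose Q ** C ** Q - Hh))\<^sup>2 +
      (norm (C - H - (Q ** (transpose Q ** C ** Q) ** transpose Q - Q ** Hh ** transpose Q)))\<^sup>2" for C
    using norm_compression_pythagoras[OF Q, of "C - H"] unfolding matrix_sandwich_diff Hh .
  \<comment> \<open>Dropping the remainder in Pythagoras: compression does not increase the distance
    to the reference matrix.\<close>
  then have le: "norm (transpose Q ** C ** Q - Hh) \<le> norm (C - H)" for C
    by (metis le_add_same_cancel1 norm_ge_zero power2_le_imp_le zero_le_power2)
  show ?thesis
  proof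
    assume L: ?L
    then have A: "A \<in> sym_matrices"
      and Af: "lfu_feasible fh 0 m dh (transpose Q *v \<alpha>, transpose Q ** A ** Q)"
      by (auto simp: lfu_minimizers_iff feas)
    have bound: "norm (A - H) \<le> norm (B - Hh)" if B: "lfu_feasible fh 0 m dh (\<beta>, B)" for \<beta> B
    proof -
      \<comment> \<open>The lift of \<open>B\<close> that agrees with \<open>H\<close> off the range
        of the conjugation: it compresses to \<open>B\<close>, and its distance to \<open>H\<close>
        equals that of \<open>B\<close> to \<open>Hh\<close>.\<close>
      define C where "C = Q ** B ** transpose Q + (H - Q ** Hh ** transpose Q)"
      have "B \<in> sym_matrices" using B by (simp add: lfu_feasible_def)
      moreover have "Hh \<in> sym_matrices" using H by (simp add: Hh sym_matrices_compression)
      ultimately have "C \<in> sym_matrices"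
        unfolding C_def
        by (intro subspace_add subspace_diff subspace_sym_matrices sym_matrices_sandwich H)
      moreover have "transpose Q ** C ** Q = B"
        by (simp add: C_def matrix_sandwich_add matrix_sandwich_diff sandwich_cancel[OF Q] Hh)
      moreover have "transpose Q *v (Q *v \<beta>) = \<beta>"
        by (simp add: matrix_vector_mul_assoc Q del: transpose_matrix_vector)
      ultimately have "lfu_feasible f x0 m d (Q *v \<beta>, C)" using B feas by simp
      then have "norm (A - H) \<le> norm (C - H)" using L by (auto simp: lfu_minimizers_iff)
      also have "C - H = Q ** (B - Hh) ** transpose Q"
        by (simp add: C_def matrix_sandwich_diff)
      finally show ?thesis by (simp add: norm_sandwich[OF Q])
    qed
    then have ?M
      unfolding lfu_minimizers_iff using Af bound le[of A] order_trans by blast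
    \<comment> \<open>Applying \<open>bound\<close> to the compression of \<open>A\<close> itself
      gives the inequality opposite to \<open>le\<close>. Equality forces the remainder in
      \<open>pyth\<close> to vanish, which is the equation for \<open>A\<close>.\<close>
    moreover have "norm (A - H) = norm (transpose Q ** A ** Q - Hh)"
      using bound[OF Af] le[of A] by simp
    then have ?E using pyth[of A] by (simp add: algebra_simps)
    ultimately show "?M \<and> ?E" ..
  next
    assume ME: "?M \<and> ?E"
    note M = ME[THEN conjunct1] and E = ME[THEN conjunct2]
    have "Hh \<in> sym_matrices" using H by (simp add: Hh sym_matrices_compression)
    moreover have "transpose Q ** A ** Q \<in> sym_matrices"
      using M by (simp add: lfu_minimizers_iff lfu_feasible_def)
    \<comment> \<open>The subspace problem only gives symmetry of the compression; that of
      \<open>A\<close> comes from its expression through symmetric matrices.\<close>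
    ultimately have "A \<in> sym_matrices"
      by (subst E) (intro subspace_add subspace_diff subspace_sym_matrices sym_matrices_sandwich H)
    moreover have "norm (A - H) = norm (transpose Q ** A ** Q - Hh)"
    proof -
      have "A - H = Q ** (transpose Q ** A ** Q) ** transpose Q - Q ** Hh ** transpose Q"
        by (subst E) simp
      then show ?thesis
        using norm_sandwich[OF Q, of "transpose Q ** A ** Q - Hh"] by (simp add: matrix_sandwich_diff)
    qed
    \<comment> \<open>For a feasible competitor, minimality compares the compressions, and
      \<open>le\<close> then passes to the full distance.\<close>
    ultimately show ?L
      using M order_trans[OF _ le] by (simp add: lfu_minimizers_iff feas del: transpose_matrix_vector) blast
  qed
qed

section \<open>Hessian formula, gradient sets and models\<close>

lemma lfu_hessian_eqI:
  assumes "\<exists>!A. A \<in> lfu_hessians g z0 m u B" and "(\<alpha>, A) \<in> lfu_minimizers g z0 m u B"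
  shows "lfu_hessian g z0 m u B = A"
proof -
  have "A \<in> lfu_hessians g z0 m u B"
    unfolding lfu_hessians_def using assms(2) by (rule image_eqI[rotated]) simp
  then show ?thesis
    unfolding lfu_hessian_def using assms(1) by (intro the1_equality)
qed

text \<open>With the Hessian unique, the gradient set is the slice of the minimizers over that one
  matrix, which removes the existential quantifier.\<close>

lemma lfu_gradients_iff:
  assumes "\<exists>!A. A \<in> lfu_hessians g z0 m u B"
  shows "\<alpha> \<in> lfu_gradients g z0 m u B \<longleftrightarrow>
    (\<alpha>, lfu_hessian g z0 m u B) \<in> lfu_minimizers g z0 m u B"
proof -
  have "\<alpha> \<in> lfu_gradients g z0 m u B \<longleftrightarrow> (\<exists>A. (\<alpha>, A) \<in> lfu_minimizers g z0 m u B)"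
    by (force simp: lfu_gradients_def)
  then show ?thesis using lfu_hessian_eqI[OF assms] by blast
qed

theorem theorem3:
  fixes f :: "real^'n \<Rightarrow> real" and x0 :: "real^'n" and H :: "real^'n^'n"
    and m :: nat and d :: "nat \<Rightarrow> real^'n" and Y :: "(real^'n) set"
    and Q :: "real^'d^'n" and dh :: "nat \<Rightarrow> real^'d"
    and fh :: "real^'d \<Rightarrow> real" and Hh :: "real^'d^'d"
  assumes "H \<in> sym_matrices"
    and "Y = sample_set x0 m d"
    and "CARD('d) < CARD('n)"
    and "orthonormal_columns Q"
    and "Y \<subseteq> {x0 + Q *v xh |xh. xh \<in> UNIV}"
    and "\<exists>q. quadratic_function q \<and> (\<forall>y\<in>Y. q y = f y)"
    and "\<forall>i\<in>{1..m}. d i = Q *v dh i"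
    and "\<forall>xh. fh xh = f (x0 + Q *v xh)"
    and "Hh = transpose Q ** H ** Q"
  shows
    "(\<exists>!A. A \<in> lfu_hessians f x0 m d H) \<and>
     (\<exists>!A. A \<in> lfu_hessians fh 0 m dh Hh) \<and>
     lfu_hessian f x0 m d H =
       Q ** lfu_hessian fh 0 m dh Hh ** transpose Q
         + H - Q ** transpose Q ** H ** Q ** transpose Q
     \<and>
     lfu_gradients f x0 m d H =
       {Q *v \<alpha> |\<alpha>. \<alpha> \<in> lfu_gradients fh 0 m dh Hh} + (col_space Q)\<^sup>\<bottom>
     \<and>
     (\<forall>\<alpha> \<in> lfu_gradients f x0 m d H. \<forall>\<alpha>h \<in> lfu_gradients fh 0 m dh Hh.
        \<alpha> - Q *v \<alpha>h \<in> (col_space Q)\<^sup>\<bottom> \<longrightarrow>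
        (\<forall>x xh. x = x0 + Q *v xh \<longrightarrow>
           lfu_model f x0 m d H \<alpha> x = lfu_model fh 0 m dh Hh \<alpha>h xh))
     \<and>
     (\<forall>\<alpha> \<in> lfu_gradients f x0 m d H. \<forall>\<alpha>h \<in> lfu_gradients fh 0 m dh Hh.
        H = Q ** transpose Q ** H ** Q ** transpose Q \<and> \<alpha> = Q *v \<alpha>h \<longrightarrow>
        (\<forall>x xh. x \<in> {x0 + Q *v xh} + (col_space Q)\<^sup>\<bottom> \<longrightarrow>
           lfu_model f x0 m d H \<alpha> x = lfu_model fh 0 m dh Hh \<alpha>h xh))"
proof -
  have Q: "transpose Q ** Q = mat 1"
    using assms(4) by (rule transpose_mult_self_orthonormal)
  have QtQ: "transpose Q *v (Q *v v) = v" for v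
    by (simp add: matrix_vector_mul_assoc Q del: transpose_matrix_vector)
  obtain \<alpha>0 A0 where full: "lfu_feasible f x0 m d (\<alpha>0, A0)"
    using assms(2,6) quadratic_function_lfu_feasible by blast
  \<comment> \<open>The subspace problem inherits feasibility by compressing the full feasible
    pair.\<close>
  then have "lfu_feasible fh 0 m dh (transpose Q *v \<alpha>0, transpose Q ** A0 ** Q)"
    using lfu_feasible_compression_iff[OF _ assms(7,8)] by (auto simp: lfu_feasible_def)
  then have unih: "\<exists>!A. A \<in> lfu_hessians fh 0 m dh Hh" by (rule lfu_hessians_ex1)
  have uni: "\<exists>!A. A \<in> lfu_hessians f x0 m d H" using full by (rule lfu_hessians_ex1)
  note min_iff = lfu_minimizers_compression_iff[where f = f and ?x0.0 = x0 and \<alpha> = \<alpha> and A = A for \<alpha> A,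
      OF assms(1) Q assms(7,8,9)]
  define A where "A = lfu_hessian f x0 m d H"
  define Ah where "Ah = lfu_hessian fh 0 m dh Hh"
  obtain \<alpha>1 where "(\<alpha>1, A) \<in> lfu_minimizers f x0 m d H"
    using theI'[OF uni] by (auto simp: A_def lfu_hessian_def lfu_hessians_def)
  then have m1: "(transpose Q *v \<alpha>1, transpose Q ** A ** Q) \<in> lfu_minimizers fh 0 m dh Hh"
    and A: "A = Q ** (transpose Q ** A ** Q) ** transpose Q + H - Q ** Hh ** transpose Q"
    by (auto simp only: min_iff)
  have QAQ: "transpose Q ** A ** Q = Ah"
    using lfu_hessian_eqI[OF unih m1] by (simp add: Ah_def)
  have hess: "A = Q ** Ah ** transpose Q + H - Q ** transpose Q ** H ** Q ** transpose Q"
    using A unfolding QAQ by (simp add: assms(9) matrix_mul_assoc)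
  \<comment> \<open>Once the Hessian is fixed to \<open>A\<close>, the matrix equation in
    \<open>min_iff\<close> holds for every \<open>\<alpha>\<close>, so only the condition on
    \<open>transpose Q *v \<alpha>\<close> remains.\<close>
  have grad: "\<alpha> \<in> lfu_gradients f x0 m d H \<longleftrightarrow>
      transpose Q *v \<alpha> \<in> lfu_gradients fh 0 m dh Hh" for \<alpha>
    using A unfolding lfu_gradients_iff[OF uni] lfu_gradients_iff[OF unih]
      A_def[symmetric] Ah_def[symmetric] min_iff QAQ by simp
  have grads: "lfu_gradients f x0 m d H =
      {Q *v \<alpha> |\<alpha>. \<alpha> \<in> lfu_gradients fh 0 m dh Hh} + (col_space Q)\<^sup>\<bottom>"
  proof (intro set_eqI iffI)
    fix \<alpha> assume "\<alpha> \<in> lfu_gradients f x0 m d H"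
    then have "transpose Q *v \<alpha> \<in> lfu_gradients fh 0 m dh Hh" by (simp only: grad)
    \<comment> \<open>Split \<open>\<alpha>\<close> by the orthogonal projection
      \<open>Q ** transpose Q\<close> onto the column space.\<close>
    moreover have "\<alpha> - Q *v (transpose Q *v \<alpha>) \<in> (col_space Q)\<^sup>\<bottom>"
      by (simp add: mem_col_space_comp_iff matrix_vector_mult_diff_distrib QtQ
          del: transpose_matrix_vector)
    moreover have "\<alpha> = Q *v (transpose Q *v \<alpha>) + (\<alpha> - Q *v (transpose Q *v \<alpha>))" by simp
    ultimately show "\<alpha> \<in> {Q *v \<alpha> |\<alpha>. \<alpha> \<in> lfu_gradients fh 0 m dh Hh} + (col_space Q)\<^sup>\<bottom>"
      unfolding set_plus_def by blast
  next
    fix \<alpha> assume "\<alpha> \<in> {Q *v \<alpha> |\<alpha>. \<alpha> \<in> lfu_gradients fh 0 m dh Hh} + (col_space Q)\<^sup>\<bottom>"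
    then obtain \<gamma> w where "\<gamma> \<in> {Q *v \<alpha> |\<alpha>. \<alpha> \<in> lfu_gradients fh 0 m dh Hh}"
      "w \<in> (col_space Q)\<^sup>\<bottom>" "\<alpha> = \<gamma> + w"
      by (rule set_plus_elim)
    then obtain \<beta> where "\<alpha> = Q *v \<beta> + w" "\<beta> \<in> lfu_gradients fh 0 m dh Hh" "transpose Q *v w = 0"
      unfolding mem_col_space_comp_iff by blast
    then show "\<alpha> \<in> lfu_gradients f x0 m d H"
      unfolding grad by (simp add: matrix_vector_right_distrib QtQ del: transpose_matrix_vector)
  qed
  have base: "fh 0 = f x0" using assms(8) by simp
  have model: "lfu_model f x0 m d H \<alpha> x = lfu_model fh 0 m dh Hh \<alpha>h xh"
    if "\<alpha> - Q *v \<alpha>h \<in> (col_space Q)\<^sup>\<bottom>" "x = x0 + Q *v xh" for \<alpha> \<alpha>h x xh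
  proof -
    have \<alpha>h: "transpose Q *v \<alpha> = \<alpha>h"
      using that(1) by (simp add: mem_col_space_comp_iff matrix_vector_mult_diff_distrib QtQ
          del: transpose_matrix_vector)
    have "\<alpha> \<bullet> (Q *v xh) = \<alpha>h \<bullet> xh"
      by (metis \<alpha>h inner_commute inner_matrix_vector_transpose)
    \<comment> \<open>Along the subspace the quadratic form of \<open>A\<close> sees only its
      compression, which is \<open>Ah\<close> by \<open>QAQ\<close>.\<close>
    moreover have "(Q *v xh) \<bullet> (A *v (Q *v xh)) = xh \<bullet> (Ah *v xh)"
      by (simp add: inner_matrix_vector_transpose matrix_vector_mul_assoc matrix_mul_assoc QAQ[symmetric]
          del: transpose_matrix_vector)
    ultimately show ?thesis
      by (simp add: lfu_model_def that(2) base flip: A_def Ah_def)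
  qed
  have model': "lfu_model f x0 m d H \<alpha> x = lfu_model fh 0 m dh Hh \<alpha>h xh"
    if HP: "H = Q ** transpose Q ** H ** Q ** transpose Q" and \<alpha>: "\<alpha> = Q *v \<alpha>h"
      and x: "x \<in> {x0 + Q *v xh} + (col_space Q)\<^sup>\<bottom>" for \<alpha> \<alpha>h x xh
  proof -
    obtain w where "w \<in> (col_space Q)\<^sup>\<bottom>" "x = x0 + Q *v xh + w"
      using x by (elim set_plus_elim) simp
    then have w: "x = x0 + Q *v xh + w" "transpose Q *v w = 0"
      by (simp_all only: mem_col_space_comp_iff)
    \<comment> \<open>The hypothesis on \<open>H\<close> cancels the correction term, so
      \<open>A\<close> annihilates the complement of the column space. Since \<open>\<alpha>\<close>
      lies in the column space, neither term of the model sees \<open>w\<close>.\<close>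
    have A': "A = Q ** Ah ** transpose Q"
      using hess HP by (metis add_diff_cancel_right')
    have Qx: "transpose Q *v (x - x0) = xh"
      using w by (simp add: matrix_vector_right_distrib QtQ del: transpose_matrix_vector)
    have "\<alpha> \<bullet> (x - x0) = \<alpha>h \<bullet> xh"
      by (simp only: \<alpha> inner_matrix_vector_transpose Qx)
    moreover have "(x - x0) \<bullet> (A *v (x - x0)) = xh \<bullet> (Ah *v xh)"
    proof -
      have "A *v (x - x0) = Q *v (Ah *v xh)"
        unfolding A' Qx[symmetric] by (simp only: matrix_vector_mul_assoc matrix_mul_assoc)
      then have "(x - x0) \<bullet> (A *v (x - x0)) = (Ah *v xh) \<bullet> xh"
        by (simp only: inner_commute[of "x - x0"] inner_matrix_vector_transpose Qx)
      then show ?thesis by (simp only: inner_commute)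
    qed
    ultimately show ?thesis
      by (simp add: lfu_model_def base flip: A_def Ah_def)
  qed
  show ?thesis
    using uni unih hess[unfolded A_def Ah_def] grads model model' by blast
qed

end
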